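(* Let $\varepsilon>0$. If the candidates'-set algorithm (described in the context) queries at each iteration a $(1+\varepsilon)$-median of the current candidates' set for the potential function $\Phi$, then at least $\Omega(\sqrt{n})$ queries are required in the worst case to detect the target $t$ in a graph $G$ with $n$ vertices, even if $G$ is a tree. That is, there is a constant $c>0$ (possibly depending on $\varepsilon$) such that for all sufficiently large $n$ there are a tree $G$ with $n$ vertices, a target $t$ in $G$, and a choice of $(1+\varepsilon)$-medians at the iterations of the algorithm, for which the algorithm makes at least $c\sqrt{n}$ queries before detecting $t$.
   Context: Graphs $G=(V,E)$ are connected, simple, undirected, with positive edge weights $w$; $d$ is the shortest-path distance, and $N(v)$ is the set of neighbors of $v$. For $u\in N(v)$, $N(v,u)=\{x\in V: d(v,x)=w(vu)+d(u,x)\}$. There is one unknown target $t\in V$. A direction query at $v$ reveals that $v=t$ if this is the case, and otherwise returns a neighbor $u\in N(v)$ with $t\in N(v,u)$. For $S\subseteq V$ and $v\in V$, $\Phi_S(v)=\sum_{u\in S}d(v,u)$. A vertex $x\in V$ is a $(1+\varepsilon)$-median of $S$ for $\Phi$ (a $(1+\varepsilon)$-approximate minimizer) if $\Phi_S(x)\le(1+\varepsilon)\min_{v\in V}\Phi_S(v)$. The candidates'-set algorithm: it maintains a set $S\subseteq V$ with $t\in S$, initially $S=V$. At each iteration it queries a vertex $v$ that is a ($(1+\varepsilon)$-)median of $S$, and, if the response is $u\in N(v)$, it replaces $S$ by $S\cap N(v,u)$. It stops when the target is revealed or $|S|=1$. *)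

theory Defs
  imports "Graph_Theory.Graph_Theory"
begin

(* Simple undirected graphs are the symmetric loop-free digraphs of pair_graph: every edge {u,v}
   appears as the two arcs (u,v) and (v,u). *)
locale weighted_graph = pair_graph G for G :: "'a pair_pre_digraph" +
  fixes w :: "'a \<times> 'a \<Rightarrow> real"
  assumes connected: "Digraph_Component.connected (with_proj G)"
    and weight_pos: "(u, v) \<in> parcs G \<Longrightarrow> w (u, v) > 0"
    and weight_sym: "(u, v) \<in> parcs G \<Longrightarrow> w (u, v) = w (v, u)"
begin

(* \<mu> is extended-real valued; it is finite between vertices here, since the graph is connected
   and the weights are positive. *)
definition d :: "'a \<Rightarrow> 'a \<Rightarrow> real" where
  "d u v = real_of_ereal (\<mu> w u v)"

(* The library predicates forest and tree are unsuitable for symmetric digraphs: they forbid all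
   directed cycles, including [(u,v), (v,u)].  The undirected cycles are those with at least
   three arcs; connectedness is already assumed by the locale. *)
definition is_tree :: bool where
  "is_tree \<longleftrightarrow> \<not> (\<exists>p. cycle p \<and> length p \<ge> 3)"

definition nbrs :: "'a \<Rightarrow> 'a set" where
  "nbrs v = {u. (v, u) \<in> parcs G}"

definition consistent :: "'a \<Rightarrow> 'a \<Rightarrow> 'a set" where
  "consistent v u = {x \<in> pverts G. d v x = w (v, u) + d u x}"

definition potential :: "'a set \<Rightarrow> 'a \<Rightarrow> real" where
  "potential S v = (\<Sum>u\<in>S. d v u)"

(* A (1 + \<epsilon>)-median; it need not belong to S. *)
definition approx_median :: "real \<Rightarrow> 'a set \<Rightarrow> 'a \<Rightarrow> bool" where
  "approx_median \<epsilon> S x \<longleftrightarrow>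
     x \<in> pverts G \<and> potential S x \<le> (1 + \<epsilon>) * (MIN v\<in>pverts G. potential S v)"

(* run \<epsilon> t S qs: with target t, the algorithm can continue from the candidates' set S by making
   exactly the queries qs, in this order, and then stop.  The choice of the approximate medians,
   and of the answers when several are correct, is nondeterministic. *)
inductive run :: "real \<Rightarrow> 'a \<Rightarrow> 'a set \<Rightarrow> 'a list \<Rightarrow> bool" for \<epsilon> :: real and t :: 'a where
  singleton: "card S = 1 \<Longrightarrow> run \<epsilon> t S []"
| found: "card S \<noteq> 1 \<Longrightarrow> approx_median \<epsilon> S t \<Longrightarrow> run \<epsilon> t S [t]"
| step: "card S \<noteq> 1 \<Longrightarrow> approx_median \<epsilon> S v \<Longrightarrow> v \<noteq> t \<Longrightarrow>
    u \<in> nbrs v \<Longrightarrow> t \<in> consistent v u \<Longrightarrow>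
    run \<epsilon> t (S \<inter> consistent v u) qs \<Longrightarrow> run \<epsilon> t S (v # qs)"

end

end

theory Submission
  imports Defs
begin

text \<open>
  Take a star in which one leaf, the target, is at distance 1 from the centre and every other leaf
  is at distance \<open>\<delta> = \<epsilon> / (2 n)\<close>.  As long as the centre and the target are candidates, every
  potential is at least 1 by the triangle inequality, whereas the potential of a short leaf is at
  most \<open>1 + 2 n \<delta>\<close>.  So every short leaf is an admissible query, and such a query eliminates only
  the queried leaf.  This even gives a linear number of queries.
\<close>

definition star :: "nat \<Rightarrow> nat pair_pre_digraph" where
  "star n = \<lparr>pverts = {..<n}, parcs = {0} \<times> {1..<n} \<union> {1..<n} \<times> {0}\<rparr>"

text \<open>Since \<open>r 0 = 0\<close> below, this is the length of the leg of the leaf at the other end of an arc.\<close>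

definition star_weight :: "(nat \<Rightarrow> real) \<Rightarrow> nat \<times> nat \<Rightarrow> real" where
  "star_weight r e = r (fst e) + r (snd e)"

text \<open>The leg lengths stay arbitrary here. Giving the centre a leg of length 0 lets
  \<open>r u + r v\<close> serve as the distance of any two distinct vertices.\<close>

locale weighted_star =
  fixes n :: nat and r :: "nat \<Rightarrow> real"
  assumes n_pos: "n > 0"
    and r_centre: "r 0 = 0"
    and r_leaf: "i > 0 \<Longrightarrow> r i > 0"

sublocale weighted_star \<subseteq> pair_graph "star n"
  by unfold_locales (auto simp: star_def symmetric_def arcs_ends_conv intro!: symI)

context weighted_star
begin

lemma pverts_star [simp]: "pverts (star n) = {..<n}"
  by (simp add: star_def)

lemma parcs_star [simp]: "parcs (star n) = {0} \<times> {1..<n} \<union> {1..<n} \<times> {0}"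
  by (simp add: star_def)

text \<open>The direct route through the centre; it yields both the upper bound on the distance and
  connectedness.\<close>

lemma ex_walk:
  assumes "u < n" "v < n"
  obtains p where "awalk u p v"
    and "awalk_cost (star_weight r) p = (if u = v then 0 else r u + r v)"
proof -
  consider "u = v" | "u \<noteq> v" "u = 0 \<or> v = 0" | "u \<noteq> v" "u > 0" "v > 0" by blast
  then show thesis
  proof cases
    case 1
    with assms show thesis by (intro that[of "[]"]) (auto simp: awalk_simps)
  next
    case 2
    with assms show thesis
      by (intro that[of "[(u, v)]"]) (auto simp: awalk_simps star_weight_def)
  next
    case 3
    with assms show thesis
      by (intro that[of "[(u, 0), (0, v)]"]) (auto simp: awalk_simps star_weight_def r_centre)
  qed
qed

lemma r_nonneg: "r i \<ge> 0"
  using r_centre r_leaf[of i] by (cases i) auto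

text \<open>An arc pays the legs of both its ends, so the first arc pays \<open>r u\<close> and the
  last pays \<open>r v\<close>, even if they are the same arc.\<close>

lemma walk_cost_ge:
  assumes "awalk u p v"
  shows "awalk_cost (star_weight r) p \<ge> (if u = v then 0 else r u + r v)"
  using assms
proof (induction p arbitrary: u)
  case Nil
  then show ?case by (auto simp: awalk_simps)
next
  case (Cons e p)
  then have "fst e = u" "awalk (snd e) p v" by (auto simp: awalk_simps)
  then show ?case
    using Cons.IH[of "snd e"] r_nonneg[of u] r_nonneg[of v] r_nonneg[of "snd e"]
    by (auto simp: star_weight_def split: if_splits)
qed

lemma shortest_path_star:
  assumes "u < n" "v < n"
  shows "\<mu> (star_weight r) u v = ereal (if u = v then 0 else r u + r v)"
proof (rule antisym)
  obtain p where "awalk u p v"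
    and "awalk_cost (star_weight r) p = (if u = v then 0 else r u + r v)"
    using ex_walk assms by blast
  then show "\<mu> (star_weight r) u v \<le> ereal (if u = v then 0 else r u + r v)"
    using min_cost_le_walk_cost by metis
  show "ereal (if u = v then 0 else r u + r v) \<le> \<mu> (star_weight r) u v"
    unfolding \<mu>_def using walk_cost_ge by (intro INF_greatest) auto
qed

end

sublocale weighted_star \<subseteq> weighted_graph "star n" "star_weight r"
proof
  have "u \<rightarrow>\<^sup>*\<^bsub>with_proj (star n)\<^esub> v" if "u < n" "v < n" for u v
    using ex_walk[OF that] reachable_awalkI by blast
  then show "Digraph_Component.connected (with_proj (star n))"
    unfolding Digraph_Component.connected_def strongly_connected_def
    using n_pos reachable_mk_symmetricI by auto
qed (auto simp: star_weight_def r_centre r_leaf)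

context weighted_star
begin

lemma d_star: "u < n \<Longrightarrow> v < n \<Longrightarrow> d u v = (if u = v then 0 else r u + r v)"
  by (simp add: d_def shortest_path_star)

text \<open>Every arc has exactly one end at \<open>0\<close>, so a walk visits \<open>0\<close> at
  every second vertex. A closed walk of length at least 3 therefore meets \<open>0\<close> twice
  after its start.\<close>

lemma is_tree_star: "is_tree"
  unfolding is_tree_def
proof (intro notI, elim exE conjE)
  fix p assume "cycle p" "length p \<ge> 3"
  from \<open>length p \<ge> 3\<close> obtain e1 e2 e3 q where p: "p = e1 # e2 # e3 # q"
    by (auto simp: numeral_3_eq_3 Suc_le_length_iff)
  obtain u where walk: "awalk u p u" and dist: "distinct (tl (awalk_verts u p))"
    using \<open>cycle p\<close> unfolding cycle_def by auto
  \<comment> \<open>If \<open>u\<close> is a leaf, \<open>snd e1\<close> and \<open>snd e3\<close>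
    are both \<open>0\<close>. If \<open>u = 0\<close>, then \<open>snd e2 = 0\<close>, and the
    second visit is the return to \<open>u\<close>, which happens at \<open>snd e3\<close> or
    later.\<close>
  have "awalk (snd e3) q u" using walk by (auto simp: p awalk_Cons_iff)
  then have "last (pawalk_verts (snd e3) q) = u" "pawalk_verts (snd e3) q \<noteq> []"
    using awlast_of_awalk awalk_verts_non_Nil by (auto simp: awalk_def awlast_if_cas)
  then have "u \<in> set (pawalk_verts (snd e3) q)" using last_in_set by metis
  with walk dist show False
    by (cases q) (auto simp: p awalk_simps)
qed

lemma consistent_leaf:
  assumes "0 < v" "v < n"
  shows "consistent v 0 = {..<n} - {v}"
  using assms n_pos r_leaf[of v] by (auto simp: consistent_def d_star star_weight_def r_centre)

text \<open>\<open>A\<close> holds the short leaves not yet eliminated. Each costs one query, and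
  the extra one is the final query of the target \<open>1\<close>.\<close>

lemma run_star:
  assumes "finite A" "A \<subseteq> {2..<n}" "n \<ge> 2" "\<epsilon> \<ge> 0" "r 1 = 1"
    and short: "\<And>i. i \<ge> 2 \<Longrightarrow> r i = \<epsilon> / (2 * n)"
  shows "\<exists>qs. run \<epsilon> 1 ({0, 1} \<union> A) qs \<and> length qs = card A + 1"
  using assms(1,2)
proof (induction A)
  have min_ge: "(MIN v\<in>{..<n}. potential ({0, 1} \<union> A) v) \<ge> 1" if "A \<subseteq> {2..<n}" for A
  proof -
    have "potential ({0, 1} \<union> A) v \<ge> 1" if "v < n" for v
    proof -
      have "1 \<le> d v 0 + d v 1"
        using \<open>v < n\<close> \<open>n \<ge> 2\<close> \<open>r 1 = 1\<close> r_nonneg[of v] by (auto simp: d_star r_centre)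
      also have "\<dots> = (\<Sum>u\<in>{0, 1}. d v u)" by simp
      also have "\<dots> \<le> potential ({0, 1} \<union> A) v"
        unfolding potential_def using \<open>A \<subseteq> {2..<n}\<close> \<open>v < n\<close> \<open>n \<ge> 2\<close>
        by (intro sum_mono2) (auto simp: finite_subset d_star r_nonneg)
      finally show ?thesis .
    qed
    then show ?thesis using n_pos by (subst Min_ge_iff) auto
  qed
  have median: "approx_median \<epsilon> ({0, 1} \<union> A) v"
    if "v < n" "A \<subseteq> {2..<n}" "potential ({0, 1} \<union> A) v \<le> 1 + \<epsilon>" for v A
  proof -
    have "1 + \<epsilon> \<le> (1 + \<epsilon>) * (MIN v\<in>{..<n}. potential ({0, 1} \<union> A) v)"
      using mult_left_mono[OF min_ge[OF \<open>A \<subseteq> {2..<n}\<close>], of "1 + \<epsilon>"] \<open>\<epsilon> \<ge> 0\<close> by simp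
    with that show ?thesis by (simp add: approx_median_def)
  qed
  {
    case empty
    \<comment> \<open>With only the edge from \<open>0\<close> to \<open>1\<close> left, the target
      has potential exactly 1, the lower bound.\<close>
    have "approx_median \<epsilon> ({0, 1} \<union> {}) 1"
      using \<open>n \<ge> 2\<close> \<open>\<epsilon> \<ge> 0\<close> \<open>r 1 = 1\<close>
      by (intro median) (auto simp: potential_def d_star r_centre)
    then have "run \<epsilon> 1 ({0, 1} \<union> {}) [1]" by (intro run.found) auto
    then show ?case by fastforce
  next
    case (insert v A)
    let ?S = "{0, 1} \<union> insert v A"
    from insert obtain qs where qs: "run \<epsilon> 1 ({0, 1} \<union> A) qs" "length qs = card A + 1"
      by auto
    have v: "2 \<le> v" "v < n" and A: "A \<subseteq> {2..<n}" using insert.prems by auto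
    have "card A + 1 = card (insert v A)" using insert.hyps by simp
    also have "\<dots> \<le> n - 2" using card_mono[OF _ insert.prems] by simp
    finally have card: "real (card A) + 3 \<le> n" using v by linarith
    \<comment> \<open>Two short legs add up to \<open>\<epsilon> / n\<close>. This is the distance
      from \<open>v\<close> to each leaf in \<open>A\<close>, and also the excess of
      \<open>d v 0 + d v 1\<close> over 1.\<close>
    have "potential ?S v = d v 0 + d v 1 + (d v v + (\<Sum>u\<in>A. d v u))"
      using v A insert.hyps by (subst potential_def, subst sum.union_disjoint) auto
    also have "(\<Sum>u\<in>A. d v u) = (\<Sum>u\<in>A. \<epsilon> / n)"
      using v A insert.hyps by (intro sum.cong) (auto simp: d_star short subset_iff)
    also have "d v 0 + d v 1 + (d v v + (\<Sum>u\<in>A. \<epsilon> / n)) = 1 + (\<epsilon> / n) * (card A + 1)"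
      using v \<open>n \<ge> 2\<close> \<open>r 1 = 1\<close> by (simp add: d_star r_centre short field_simps)
    also have "(\<epsilon> / n) * (card A + 1) \<le> (\<epsilon> / n) * n"
      using card \<open>\<epsilon> \<ge> 0\<close> by (intro mult_left_mono) auto
    finally have "approx_median \<epsilon> ?S v"
      using v insert.prems n_pos by (intro median) auto
    moreover have "card ?S \<noteq> 1"
      using insert.hyps A v by (subst card_Un_disjoint) auto
    moreover have "?S \<inter> consistent v 0 = {0, 1} \<union> A"
      using v A insert.hyps \<open>n \<ge> 2\<close> by (subst consistent_leaf) auto
    moreover have "0 \<in> nbrs v" "1 \<in> consistent v 0"
      using v \<open>n \<ge> 2\<close> by (auto simp: nbrs_def consistent_leaf)
    ultimately have "run \<epsilon> 1 ?S (v # qs)"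
      using v qs by (intro run.step[where u = 0]) auto
    then show ?case using qs insert.hyps by (intro exI[of _ "v # qs"]) auto
  }
qed

end

theorem theorem3:
  fixes \<epsilon> :: real
  assumes "\<epsilon> > 0"
  shows "\<exists>c>0. \<exists>n\<^sub>0. \<forall>n\<ge>n\<^sub>0. \<exists>(G :: nat pair_pre_digraph) w t qs.
           weighted_graph G w \<and> weighted_graph.is_tree G \<and> card (pverts G) = n \<and>
           t \<in> pverts G \<and> weighted_graph.run G w \<epsilon> t (pverts G) qs \<and>
           real (length qs) \<ge> c * sqrt (real n)"
\<comment> \<open>The run makes \<open>n - 1\<close> queries, and \<open>n - 1\<close> is at least
  \<open>n / 2\<close> once \<open>n \<ge> 2\<close>.\<close>
proof (intro exI[of _ "1 / 2"] exI[of _ 2] conjI allI impI)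
  fix n :: nat assume n: "n \<ge> 2"
  define r :: "nat \<Rightarrow> real" where
    "r i = (if i = 0 then 0 else if i = 1 then 1 else \<epsilon> / (2 * n))" for i
  interpret weighted_star n r
    using assms n by unfold_locales (auto simp: r_def)
  have "\<exists>qs. run \<epsilon> 1 ({0, 1} \<union> {2..<n}) qs \<and> length qs = card {2..<n} + 1"
    using assms n by (intro run_star) (auto simp: r_def)
  moreover have "{0, 1} \<union> {2..<n} = pverts (star n)" using n by auto
  ultimately obtain qs where qs: "run \<epsilon> 1 (pverts (star n)) qs" "length qs = card {2..<n} + 1"
    by metis
  have "sqrt n \<le> n" using n by (intro real_le_lsqrt) (auto simp: power2_eq_square)
  then have "1 / 2 * sqrt n \<le> length qs" using n qs(2) by (simp add: of_nat_diff)
  then show "\<exists>(G :: nat pair_pre_digraph) w t qs.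
      weighted_graph G w \<and> weighted_graph.is_tree G \<and> card (pverts G) = n \<and>
      t \<in> pverts G \<and> weighted_graph.run G w \<epsilon> t (pverts G) qs \<and>
      real (length qs) \<ge> 1 / 2 * sqrt (real n)"
    using weighted_graph_axioms is_tree_star qs(1) n
    by (intro exI[of _ "star n"] exI[of _ "star_weight r"] exI[of _ 1] exI[of _ qs]) auto
qed simp

end
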